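(* Fix $n_1,d_1,d_2\in\mathbb N$ and suppose that $G_1=(V_1,E_1)$ is an $n_1$-vertex graph which is $d_1$-regular and that $G_2=(V_2,E_2)$ is a $d_1$-vertex graph which is $d_2$-regular. Then (for every choice of labeling in the definition of the derandomized square $G_1 ⓢ G_2$) for every kernel $K:X\times X\to[0,\infty)$ we have $$\gamma_+\left(G_1 ⓢ G_2,K\right)\le\gamma_+\left(G_1^2,K\right)\gamma_+\left(G_2,K\right).$$
   Context: Graphs are finite and undirected, with self loops and multiple edges allowed: a graph $G=(V,E)$ consists of a finite set $V$ and nonnegative integers $E(u,v)=E(v,u)$. The degree of $u$ is $\sum_vE(u,v)$ (each self loop contributes $1$); $G$ is $d$-regular if all degrees equal $d$; its normalized adjacency matrix is $A_G=(E(u,v)/d)_{u,v}$. $G^2$ is the graph on $V$ in which $u,v$ are joined by one edge for each walk of length $2$ in $G$ from $u$ to $v$; thus $A_{G^2}=(A_G)^2$. A kernel on a set $X$ is a symmetric function $K:X\times X\to[0,\infty)$. For an $n\times n$ symmetric stochastic matrix $A=(a_{ij})$, $\gamma_+(A,K)\in[0,\infty]$ is the infimum over those $\gamma_+>0$ such that for all $x_1,\ldots,x_n,y_1,\ldots,y_n\in X$, $$\frac1{n^2}\sum_{i,j=1}^nK(x_i,y_j)\le\frac{\gamma_+}{n}\sum_{i,j=1}^na_{ij}K(x_i,y_j)$$ ($\infty$ if there is no finite such $\gamma_+$). For a regular graph $G$, $\gamma_+(G,K)=\gamma_+(A_G,K)$. Derandomized square. Regard $E_1$ as a multiset of ordered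 pairs containing $E_1(u,v)$ copies of $(u,v)$. For every $w\in V_1$ fix a bijection $\pi_w$ from the $d_1$ edge copies of the form $(w,\cdot)$ onto $V_2$ (the labeling). The derandomized square $G_1 ⓢ G_2$ is the $d_1d_2$-regular graph with vertex set $V_1$ in which the number of edges joining $u$ and $v$ is $$\sum_{w\in V_1}\ \sum_{e\text{ a copy of }(w,u)}\ \sum_{e'\text{ a copy of }(w,v)}E_2\big(\pi_w(e),\pi_w(e')\big).$$ *)

theory Defs
  imports Complex_Main "HOL-Library.FuncSet" "HOL-Library.Extended_Nonnegative_Real"
begin

(* Only the values of mult G on verts G matter. *)
record 'a multigraph =
  verts :: "'a set"
  mult :: "'a \<Rightarrow> 'a \<Rightarrow> nat"

definition is_graph :: "'a multigraph \<Rightarrow> bool" where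
  "is_graph G \<longleftrightarrow> finite (verts G) \<and>
     (\<forall>u\<in>verts G. \<forall>v\<in>verts G. mult G u v = mult G v u)"

definition degree :: "'a multigraph \<Rightarrow> 'a \<Rightarrow> nat" where
  "degree G u = (\<Sum>v\<in>verts G. mult G u v)"

definition regular :: "nat \<Rightarrow> 'a multigraph \<Rightarrow> bool" where
  "regular d G \<longleftrightarrow> (\<forall>u\<in>verts G. degree G u = d)"

(* Used for d-regular graphs with d > 0 only; there degree G u = d for every vertex u. *)
definition normalized_adjacency :: "'a multigraph \<Rightarrow> 'a \<Rightarrow> 'a \<Rightarrow> real" where
  "normalized_adjacency G u v = real (mult G u v) / real (degree G u)"

(* The multiset of ordered pairs is made into a set by numbering: (u, v, k) is the k-th copy
   of (u, v). *)
definition copies :: "'a multigraph \<Rightarrow> 'a \<Rightarrow> 'a \<Rightarrow> ('a \<times> 'a \<times> nat) set" where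
  "copies G u v = {(u, v, k) | k. k < mult G u v}"

definition out_copies :: "'a multigraph \<Rightarrow> 'a \<Rightarrow> ('a \<times> 'a \<times> nat) set" where
  "out_copies G w = (\<Union>v\<in>verts G. copies G w v)"

definition walks2 ::
  "'a multigraph \<Rightarrow> 'a \<Rightarrow> 'a \<Rightarrow> (('a \<times> 'a \<times> nat) \<times> ('a \<times> 'a \<times> nat)) set" where
  "walks2 G u v = (\<Union>w\<in>verts G. copies G u w \<times> copies G w v)"

definition graph_square :: "'a multigraph \<Rightarrow> 'a multigraph" where
  "graph_square G = \<lparr>verts = verts G, mult = (\<lambda>u v. card (walks2 G u v))\<rparr>"

definition labeling ::
  "'a multigraph \<Rightarrow> 'b multigraph \<Rightarrow> ('a \<Rightarrow> 'a \<times> 'a \<times> nat \<Rightarrow> 'b) \<Rightarrow> bool" where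
  "labeling G1 G2 \<pi> \<longleftrightarrow> (\<forall>w\<in>verts G1. bij_betw (\<pi> w) (out_copies G1 w) (verts G2))"

definition derandomized_square ::
  "'a multigraph \<Rightarrow> 'b multigraph \<Rightarrow> ('a \<Rightarrow> 'a \<times> 'a \<times> nat \<Rightarrow> 'b) \<Rightarrow> 'a multigraph" where
  "derandomized_square G1 G2 \<pi> =
     \<lparr>verts = verts G1,
      mult = (\<lambda>u v. \<Sum>w\<in>verts G1. \<Sum>e\<in>copies G1 w u. \<Sum>e'\<in>copies G1 w v.
                mult G2 (\<pi> w e) (\<pi> w e'))\<rparr>"

definition kernel_on :: "'x set \<Rightarrow> ('x \<Rightarrow> 'x \<Rightarrow> real) \<Rightarrow> bool" where
  "kernel_on X K \<longleftrightarrow> (\<forall>x\<in>X. \<forall>y\<in>X. 0 \<le> K x y \<and> K x y = K y x)"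

(* The matrix A is indexed by a finite set I instead of {1..n}, so n = card I.
   The infimum of the empty set in ennreal is infinity. *)
definition gamma_plus ::
  "'i set \<Rightarrow> ('i \<Rightarrow> 'i \<Rightarrow> real) \<Rightarrow> 'x set \<Rightarrow> ('x \<Rightarrow> 'x \<Rightarrow> real) \<Rightarrow> ennreal" where
  "gamma_plus I A X K = Inf {ennreal \<gamma> | \<gamma>. 0 < \<gamma> \<and>
     (\<forall>x\<in>I \<rightarrow> X. \<forall>y\<in>I \<rightarrow> X.
        1 / (real (card I))\<^sup>2 * (\<Sum>i\<in>I. \<Sum>j\<in>I. K (x i) (y j))
        \<le> \<gamma> / real (card I) * (\<Sum>i\<in>I. \<Sum>j\<in>I. A i j * K (x i) (y j)))}"

definition graph_gamma_plus ::
  "'a multigraph \<Rightarrow> 'x set \<Rightarrow> ('x \<Rightarrow> 'x \<Rightarrow> real) \<Rightarrow> ennreal" where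
  "graph_gamma_plus G X K = gamma_plus (verts G) (normalized_adjacency G) X K"

end

theory Submission
  imports Defs
begin

text \<open>
  Both \<open>G1\<^sup>2\<close> and the derandomized square average over a middle vertex \<open>w\<close>: the square
  joins all pairs of edges at \<open>w\<close>, whereas the derandomized square joins only the pairs whose
  labels form an edge of \<open>G2\<close>. So \<open>G1\<^sup>2\<close> is the derandomized square with respect to the complete
  graph with self loops on the labels. Apply the inequality for \<open>G1\<^sup>2\<close> and then, for every \<open>w\<close>
  separately, the inequality for \<open>G2\<close> to the points obtained by pulling back along the labeling
  at \<open>w\<close>; the admissible constants multiply. The product \<open>0 \<cdot> \<infinity>\<close> causes no harm, because a
  vanishing constant forces the kernel to vanish.
\<close>

section \<open>Admissible constants and their infimum\<close>

text \<open>Isolating the condition under the infimum allows single admissible constants to be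
  multiplied before any infimum is taken.\<close>

definition poincare_const ::
  "'i set \<Rightarrow> ('i \<Rightarrow> 'i \<Rightarrow> real) \<Rightarrow> 'x set \<Rightarrow> ('x \<Rightarrow> 'x \<Rightarrow> real) \<Rightarrow> real \<Rightarrow> bool" where
  "poincare_const I A X K \<gamma> \<longleftrightarrow> 0 < \<gamma> \<and>
     (\<forall>x\<in>I \<rightarrow> X. \<forall>y\<in>I \<rightarrow> X.
        1 / (real (card I))\<^sup>2 * (\<Sum>i\<in>I. \<Sum>j\<in>I. K (x i) (y j))
        \<le> \<gamma> / real (card I) * (\<Sum>i\<in>I. \<Sum>j\<in>I. A i j * K (x i) (y j)))"

lemma gamma_plus_eq_Inf: "gamma_plus I A X K = Inf {ennreal \<gamma> | \<gamma>. poincare_const I A X K \<gamma>}"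
  by (simp add: gamma_plus_def poincare_const_def)

lemma poincare_constD:
  assumes "poincare_const I A X K \<gamma>" "x \<in> I \<rightarrow> X" "y \<in> I \<rightarrow> X"
  shows "1 / (real (card I))\<^sup>2 * (\<Sum>i\<in>I. \<Sum>j\<in>I. K (x i) (y j))
    \<le> \<gamma> / real (card I) * (\<Sum>i\<in>I. \<Sum>j\<in>I. A i j * K (x i) (y j))"
  using assms by (simp only: poincare_const_def)

lemma gamma_plus_le: "poincare_const I A X K \<gamma> \<Longrightarrow> gamma_plus I A X K \<le> ennreal \<gamma>"
  unfolding gamma_plus_eq_Inf by (rule Inf_lower) blast

lemma gamma_plus_lessD:
  assumes "gamma_plus I A X K < c"
  obtains \<gamma> where "poincare_const I A X K \<gamma>" "ennreal \<gamma> < c"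
  using assms unfolding gamma_plus_eq_Inf Inf_less_iff by blast

lemma gamma_plus_cong:
  assumes "\<And>i j. i \<in> I \<Longrightarrow> j \<in> I \<Longrightarrow> A i j = B i j"
  shows "gamma_plus I A X K = gamma_plus I B X K"
proof -
  have "(\<Sum>i\<in>I. \<Sum>j\<in>I. A i j * K (x i) (y j)) = (\<Sum>i\<in>I. \<Sum>j\<in>I. B i j * K (x i) (y j))" for x y
    by (intro sum.cong) (simp_all add: assms)
  then show ?thesis
    by (simp add: gamma_plus_def)
qed

text \<open>Constant maps \<open>x = p\<close>, \<open>y = q\<close> turn the inequality into
  \<open>K p q \<le> \<gamma> * C\<close> with \<open>C\<close> independent of \<gamma>, and
  \<gamma> can be taken arbitrarily small.\<close>

lemma kernel_eq_0_if_gamma_plus_eq_0: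
  assumes "gamma_plus I A X K = 0" "finite I" "I \<noteq> {}" "kernel_on X K" "p \<in> X" "q \<in> X"
  shows "K p q = 0"
proof (rule ccontr)
  assume "K p q \<noteq> 0"
  with assms have pos: "0 < K p q"
    by (simp add: kernel_on_def order.strict_iff_order)
  define n where "n = real (card I)"
  have n: "0 < n"
    using assms by (simp add: n_def card_gt_0_iff)
  define C where "C = (\<Sum>i\<in>I. \<Sum>j\<in>I. A i j * K p q) / n"
  \<comment> \<open>Chosen so that \<gamma> < \<epsilon> gives
    \<open>\<gamma> * (\<bar>C\<bar> + 1) < K p q\<close>; adding 1 keeps the denominator positive
    even if \<open>C\<close> is 0.\<close>
  define \<epsilon> where "\<epsilon> = K p q / (\<bar>C\<bar> + 1)"
  have "0 < \<epsilon>"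
    using pos by (simp add: \<epsilon>_def)
  then have "gamma_plus I A X K < ennreal \<epsilon>"
    using assms by simp
  then obtain \<gamma> where \<gamma>: "poincare_const I A X K \<gamma>" "ennreal \<gamma> < ennreal \<epsilon>"
    by (rule gamma_plus_lessD)
  have "0 < \<gamma>"
    using \<gamma>(1) by (simp add: poincare_const_def)
  then have less: "\<gamma> < \<epsilon>"
    using \<gamma>(2) by (simp add: ennreal_less_iff)
  have "1 / n\<^sup>2 * (\<Sum>i\<in>I. \<Sum>j\<in>I. K p q) \<le> \<gamma> / n * (\<Sum>i\<in>I. \<Sum>j\<in>I. A i j * K p q)"
    unfolding n_def
    using poincare_constD[OF \<gamma>(1), of "\<lambda>_. p" "\<lambda>_. q"] assms by simp
  then have "K p q \<le> \<gamma> * C"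
    using n by (simp add: C_def n_def[symmetric] power2_eq_square)
  also have "\<dots> \<le> \<gamma> * (\<bar>C\<bar> + 1)"
    using \<open>0 < \<gamma>\<close> by (intro mult_left_mono) auto
  also have "\<dots> < \<epsilon> * (\<bar>C\<bar> + 1)"
    using less by (intro mult_strict_right_mono) auto
  also have "\<dots> = K p q"
    by (simp add: \<epsilon>_def)
  finally show False by simp
qed

text \<open>Both sides of the inequality vanish, so every positive constant is admissible. Since 0
  itself is not, the infimum is approached by small positive reals.\<close>

lemma gamma_plus_eq_0_if_kernel_eq_0:
  fixes I :: "'i set"
  assumes "\<And>p q. p \<in> X \<Longrightarrow> q \<in> X \<Longrightarrow> K p q = 0"
  shows "gamma_plus I A X K = 0"
proof -
  have zero: "(\<Sum>i\<in>I. \<Sum>j\<in>I. c i j * K (x i) (y j)) = 0"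
    if x: "x \<in> I \<rightarrow> X" and y: "y \<in> I \<rightarrow> X" for x y and c :: "'i \<Rightarrow> 'i \<Rightarrow> real"
  proof (intro sum.neutral ballI)
    fix i j assume "i \<in> I" "j \<in> I"
    with x y have "K (x i) (y j) = 0"
      by (intro assms) (erule (1) funcset_mem)+
    then show "c i j * K (x i) (y j) = 0" by simp
  qed
  have bound: "gamma_plus I A X K \<le> ennreal \<gamma>" if "0 < \<gamma>" for \<gamma>
  proof (rule gamma_plus_le)
    show "poincare_const I A X K \<gamma>"
      unfolding poincare_const_def
    proof (intro conjI ballI)
      fix x y assume "x \<in> I \<rightarrow> X" "y \<in> I \<rightarrow> X"
      from zero[OF this, of "\<lambda>_ _. 1"] zero[OF this, of A]
      show "1 / (real (card I))\<^sup>2 * (\<Sum>i\<in>I. \<Sum>j\<in>I. K (x i) (y j))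
        \<le> \<gamma> / real (card I) * (\<Sum>i\<in>I. \<Sum>j\<in>I. A i j * K (x i) (y j))"
        by simp
    qed fact
  qed
  have "gamma_plus I A X K \<le> 0"
  proof (rule ennreal_le_epsilon)
    fix e :: real assume "0 < e"
    then show "gamma_plus I A X K \<le> 0 + ennreal e"
      using bound[of e] by simp
  qed
  then show ?thesis by simp
qed

section \<open>Counting edge copies and walks of length two\<close>

lemma finite_copies [simp]: "finite (copies G u v)"
  and card_copies [simp]: "card (copies G u v) = mult G u v"
proof -
  have eq: "copies G u v = (\<lambda>k. (u, v, k)) ` {..<mult G u v}"
    by (auto simp: copies_def)
  show "finite (copies G u v)"
    by (simp add: eq)
  show "card (copies G u v) = mult G u v"
    by (simp add: eq card_image inj_on_def)
qed

abbreviation target :: "'a \<times> 'a \<times> nat \<Rightarrow> 'a" where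
  "target e \<equiv> fst (snd e)"

lemma target_copies: "e \<in> copies G u v \<Longrightarrow> target e = v"
  by (auto simp: copies_def)

lemma target_out_copies: "e \<in> out_copies G w \<Longrightarrow> target e \<in> verts G"
  by (auto simp: out_copies_def copies_def)

lemma sum_out_copies:
  assumes "finite (verts G)"
  shows "sum f (out_copies G w) = (\<Sum>v\<in>verts G. sum f (copies G w v))"
  unfolding out_copies_def
  by (rule sum.UNION_disjoint) (use assms in \<open>auto simp: copies_def\<close>)

lemma card_walks2:
  assumes "finite (verts G)"
  shows "card (walks2 G u v) = (\<Sum>w\<in>verts G. mult G u w * mult G w v)"
proof -
  have "card (walks2 G u v) = (\<Sum>w\<in>verts G. card (copies G u w \<times> copies G w v))"
    unfolding walks2_def
    by (rule card_UN_disjoint) (use assms in \<open>auto simp: copies_def\<close>)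
  then show ?thesis
    by (simp add: card_cartesian_product)
qed

section \<open>Degrees and weighted sums of the derandomized square\<close>

lemma labelingD:
  assumes "labeling G1 G2 \<pi>" "w \<in> verts G1"
  shows "bij_betw (\<pi> w) (out_copies G1 w) (verts G2)"
  using assms by (simp add: labeling_def)

text \<open>For a fixed edge \<open>e\<close> from \<open>w\<close> to \<open>u\<close>, the
  labeling turns the sum over all \<open>e'\<close> leaving \<open>w\<close> into a vertex degree of
  \<open>G2\<close>. By symmetry of \<open>G1\<close>, the edges \<open>e\<close> entering
  \<open>u\<close> number \<open>d1\<close>.\<close>

lemma degree_derandomized_square:
  assumes G1: "is_graph G1" "regular d1 G1" and G2: "regular d2 G2"
    and lab: "labeling G1 G2 \<pi>" and u: "u \<in> verts G1"
  shows "degree (derandomized_square G1 G2 \<pi>) u = d1 * d2"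
proof -
  have fin: "finite (verts G1)"
    using G1 by (simp add: is_graph_def)
  have inner: "(\<Sum>e'\<in>out_copies G1 w. mult G2 (\<pi> w e) (\<pi> w e')) = d2"
    if "w \<in> verts G1" "e \<in> copies G1 w u" for w e
  proof -
    have bij: "bij_betw (\<pi> w) (out_copies G1 w) (verts G2)"
      using lab that(1) by (rule labelingD)
    have "e \<in> out_copies G1 w"
      using that u by (auto simp: out_copies_def)
    then have "\<pi> w e \<in> verts G2"
      using bij by (auto simp: bij_betw_def)
    then show ?thesis
      using G2 by (simp add: sum.reindex_bij_betw[OF bij] regular_def degree_def)
  qed
  have "degree (derandomized_square G1 G2 \<pi>) u =
      (\<Sum>v\<in>verts G1. \<Sum>w\<in>verts G1. \<Sum>e\<in>copies G1 w u. \<Sum>e'\<in>copies G1 w v.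
        mult G2 (\<pi> w e) (\<pi> w e'))"
    by (simp add: degree_def derandomized_square_def)
  also have "\<dots> = (\<Sum>w\<in>verts G1. \<Sum>v\<in>verts G1. \<Sum>e\<in>copies G1 w u. \<Sum>e'\<in>copies G1 w v.
        mult G2 (\<pi> w e) (\<pi> w e'))"
    by (rule sum.swap)
  also have "\<dots> = (\<Sum>w\<in>verts G1. \<Sum>e\<in>copies G1 w u. \<Sum>v\<in>verts G1. \<Sum>e'\<in>copies G1 w v.
        mult G2 (\<pi> w e) (\<pi> w e'))"
    by (intro sum.cong refl sum.swap)
  also have "\<dots> = (\<Sum>w\<in>verts G1. \<Sum>e\<in>copies G1 w u. \<Sum>e'\<in>out_copies G1 w.
        mult G2 (\<pi> w e) (\<pi> w e'))"
    by (simp add: sum_out_copies[OF fin])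
  also have "\<dots> = (\<Sum>w\<in>verts G1. mult G1 w u * d2)"
    by (simp add: inner)
  also have "\<dots> = (\<Sum>w\<in>verts G1. mult G1 u w) * d2"
    using G1 u by (simp add: is_graph_def sum_distrib_right)
  finally show ?thesis
    using G1 u by (simp add: regular_def degree_def)
qed

text \<open>Edges leaving \<open>w\<close> are parametrized by their labels:
  \<open>\<tau> w s\<close> is the neighbour of \<open>w\<close> reached along the edge labelled
  \<open>s\<close>.\<close>

lemma sum_derandomized_square:
  fixes f :: "'a \<Rightarrow> 'a \<Rightarrow> real"
  assumes fin: "finite (verts G1)" and lab: "labeling G1 G2 \<pi>"
  defines "\<tau> \<equiv> \<lambda>w s. target (inv_into (out_copies G1 w) (\<pi> w) s)"
  shows "(\<Sum>u\<in>verts G1. \<Sum>v\<in>verts G1. real (mult (derandomized_square G1 G2 \<pi>) u v) * f u v) =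
    (\<Sum>w\<in>verts G1. \<Sum>s\<in>verts G2. \<Sum>t\<in>verts G2. real (mult G2 s t) * f (\<tau> w s) (\<tau> w t))"
    (is "?L = ?R")
proof -
  \<comment> \<open>Replacing \<open>u\<close> and \<open>v\<close> by the targets of
    \<open>e\<close> and \<open>e'\<close> frees the summand of \<open>u\<close> and
    \<open>v\<close>, so that the sums over vertices and copies merge into sums over
    \<open>out_copies\<close>.\<close>
  define h where "h w e e' = real (mult G2 (\<pi> w e) (\<pi> w e')) * f (target e) (target e')" for w e e'
  have "?L = (\<Sum>u\<in>verts G1. \<Sum>v\<in>verts G1. \<Sum>w\<in>verts G1. \<Sum>e\<in>copies G1 w u. \<Sum>e'\<in>copies G1 w v.
      h w e e')"
    by (simp add: derandomized_square_def sum_distrib_right h_def target_copies)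
  also have "\<dots> = (\<Sum>u\<in>verts G1. \<Sum>w\<in>verts G1. \<Sum>v\<in>verts G1. \<Sum>e\<in>copies G1 w u. \<Sum>e'\<in>copies G1 w v.
      h w e e')"
    by (intro sum.cong refl sum.swap)
  also have "\<dots> = (\<Sum>w\<in>verts G1. \<Sum>u\<in>verts G1. \<Sum>v\<in>verts G1. \<Sum>e\<in>copies G1 w u. \<Sum>e'\<in>copies G1 w v.
      h w e e')"
    by (rule sum.swap)
  also have "\<dots> = (\<Sum>w\<in>verts G1. \<Sum>u\<in>verts G1. \<Sum>e\<in>copies G1 w u. \<Sum>v\<in>verts G1. \<Sum>e'\<in>copies G1 w v.
      h w e e')"
    by (intro sum.cong refl sum.swap)
  also have "\<dots> = (\<Sum>w\<in>verts G1. \<Sum>e\<in>out_copies G1 w. \<Sum>e'\<in>out_copies G1 w. h w e e')"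
    by (simp add: sum_out_copies[OF fin])
  also have "\<dots> = ?R"
  proof (rule sum.cong[OF refl])
    fix w assume "w \<in> verts G1"
    with lab have bij: "bij_betw (\<pi> w) (out_copies G1 w) (verts G2)"
      by (rule labelingD)
    then have inv: "\<tau> w (\<pi> w e) = target e" if "e \<in> out_copies G1 w" for e
      using that by (simp add: \<tau>_def bij_betw_def)
    show "(\<Sum>e\<in>out_copies G1 w. \<Sum>e'\<in>out_copies G1 w. h w e e') =
        (\<Sum>s\<in>verts G2. \<Sum>t\<in>verts G2. real (mult G2 s t) * f (\<tau> w s) (\<tau> w t))"
      by (simp add: sum.reindex_bij_betw[OF bij, symmetric] h_def inv)
  qed
  finally show ?thesis .
qed

section \<open>The ordinary square as a derandomized square\<close>

text \<open>Self loops are included, so for finite \<open>V\<close> each vertex has degree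
  \<open>card V\<close> and the normalized adjacency matrix averages over \<open>V\<close>.\<close>

definition complete_graph :: "'b set \<Rightarrow> 'b multigraph" where
  "complete_graph V = \<lparr>verts = V, mult = (\<lambda>_ _. 1)\<rparr>"

text \<open>With all multiplicities 1, the sum counts pairs of edges from \<open>w\<close> to
  \<open>u\<close> and to \<open>v\<close>; reversing the first edge by symmetry gives the walks
  from \<open>u\<close> to \<open>v\<close> through \<open>w\<close>.\<close>

lemma mult_graph_square_eq:
  assumes "is_graph G" "u \<in> verts G"
  shows "mult (graph_square G) u v = mult (derandomized_square G (complete_graph V) \<pi>) u v"
  using assms
  by (simp add: graph_square_def derandomized_square_def complete_graph_def is_graph_def card_walks2)

lemma graph_gamma_plus_graph_square:
  assumes "is_graph G"
  shows "graph_gamma_plus (graph_square G) X K =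
    graph_gamma_plus (derandomized_square G (complete_graph V) \<pi>) X K"
proof -
  let ?H = "derandomized_square G (complete_graph V) \<pi>"
  have verts: "verts (graph_square G) = verts G" "verts ?H = verts G"
    by (simp_all add: graph_square_def derandomized_square_def)
  have mult: "mult (graph_square G) u v = mult ?H u v" if "u \<in> verts G" for u v
    using assms that by (rule mult_graph_square_eq)
  have degree: "degree (graph_square G) u = degree ?H u" if "u \<in> verts G" for u
    by (simp add: degree_def verts mult[OF that])
  show ?thesis
    unfolding graph_gamma_plus_def verts
    by (rule gamma_plus_cong) (simp add: normalized_adjacency_def mult degree)
qed

text \<open>Serves both for \<open>G2\<close> and for the complete graph on its vertices, so that
  the two resulting sums can be compared one \<open>w\<close> at a time.\<close>

lemma sum_normalized_adjacency_derandomized_square: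
  fixes f :: "'a \<Rightarrow> 'a \<Rightarrow> real"
  assumes G1: "is_graph G1" "regular d1 G1" and G2: "regular d2 G2" and lab: "labeling G1 G2 \<pi>"
  defines "\<tau> \<equiv> \<lambda>w s. target (inv_into (out_copies G1 w) (\<pi> w) s)"
  shows "(\<Sum>u\<in>verts G1. \<Sum>v\<in>verts G1.
      normalized_adjacency (derandomized_square G1 G2 \<pi>) u v * f u v) =
    (\<Sum>w\<in>verts G1. \<Sum>s\<in>verts G2. \<Sum>t\<in>verts G2.
      real (mult G2 s t) * f (\<tau> w s) (\<tau> w t)) / (real d1 * real d2)"
proof -
  have fin: "finite (verts G1)"
    using G1 by (simp add: is_graph_def)
  have "(\<Sum>u\<in>verts G1. \<Sum>v\<in>verts G1.
      normalized_adjacency (derandomized_square G1 G2 \<pi>) u v * f u v) =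
    (\<Sum>u\<in>verts G1. \<Sum>v\<in>verts G1. real (mult (derandomized_square G1 G2 \<pi>) u v) * f u v)
      / (real d1 * real d2)"
    by (simp add: normalized_adjacency_def degree_derandomized_square[OF G1 G2 lab]
        sum_divide_distrib)
  then show ?thesis
    unfolding \<tau>_def by (simp only: sum_derandomized_square[OF fin lab])
qed

section \<open>Multiplying admissible constants\<close>

text \<open>The constant \<open>a\<close> bounds the global average by averages over all pairs of
  edges at a common \<open>w\<close>; \<open>b\<close> then bounds each of these by the average over
  pairs whose labels are adjacent in \<open>G2\<close>.\<close>

lemma poincare_const_mult:
  assumes pos: "0 < d1" "0 < d2"
    and G1: "is_graph G1" "regular d1 G1"
    and G2: "card (verts G2) = d1" "regular d2 G2"
    and lab: "labeling G1 G2 \<pi>"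
    and a: "poincare_const (verts G1)
      (normalized_adjacency (derandomized_square G1 (complete_graph (verts G2)) \<pi>)) X K a"
    and b: "poincare_const (verts G2) (normalized_adjacency G2) X K b"
  shows "poincare_const (verts G1) (normalized_adjacency (derandomized_square G1 G2 \<pi>)) X K (a * b)"
proof -
  define \<tau> where "\<tau> w s = target (inv_into (out_copies G1 w) (\<pi> w) s)" for w s
  have ab: "0 < a" "0 < b"
    using a b by (simp_all add: poincare_const_def)
  have \<tau>: "\<tau> w s \<in> verts G1" if "w \<in> verts G1" "s \<in> verts G2" for w s
  proof -
    have "s \<in> \<pi> w ` out_copies G1 w"
      using labelingD[OF lab that(1)] that(2) by (simp add: bij_betw_def)
    then show ?thesis
      unfolding \<tau>_def by (intro target_out_copies[of _ G1 w] inv_into_into)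
  qed
  have complete: "regular d1 (complete_graph (verts G2))" "labeling G1 (complete_graph (verts G2)) \<pi>"
    using G2 lab by (simp_all add: regular_def degree_def complete_graph_def labeling_def)
  \<comment> \<open>The inequality for \<open>G2\<close>, applied to the points
    \<open>x (\<tau> w s)\<close> and \<open>y (\<tau> w t)\<close> indexed by the labels at
    \<open>w\<close>.\<close>
  have local_bound:
    "(\<Sum>s\<in>verts G2. \<Sum>t\<in>verts G2. K (x (\<tau> w s)) (y (\<tau> w t))) / (real d1 * real d1)
      \<le> b * (\<Sum>s\<in>verts G2. \<Sum>t\<in>verts G2. real (mult G2 s t) * K (x (\<tau> w s)) (y (\<tau> w t)))
        / (real d1 * real d2)"
    if "x \<in> verts G1 \<rightarrow> X" "y \<in> verts G1 \<rightarrow> X" "w \<in> verts G1" for x y w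
  proof -
    have x: "(\<lambda>s. x (\<tau> w s)) \<in> verts G2 \<rightarrow> X" and y: "(\<lambda>s. y (\<tau> w s)) \<in> verts G2 \<rightarrow> X"
      using that \<tau> by auto
    have "1 / (real (card (verts G2)))\<^sup>2 * (\<Sum>s\<in>verts G2. \<Sum>t\<in>verts G2. K (x (\<tau> w s)) (y (\<tau> w t)))
        \<le> b / real (card (verts G2)) * (\<Sum>s\<in>verts G2. \<Sum>t\<in>verts G2.
          normalized_adjacency G2 s t * K (x (\<tau> w s)) (y (\<tau> w t)))"
      using poincare_constD[OF b x y] .
    moreover have "(\<Sum>s\<in>verts G2. \<Sum>t\<in>verts G2.
          normalized_adjacency G2 s t * K (x (\<tau> w s)) (y (\<tau> w t))) =
        (\<Sum>s\<in>verts G2. \<Sum>t\<in>verts G2. real (mult G2 s t) * K (x (\<tau> w s)) (y (\<tau> w t))) / real d2"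
      using G2 by (simp add: normalized_adjacency_def regular_def sum_divide_distrib)
    ultimately show ?thesis
      using G2 by (simp add: power2_eq_square)
  qed
  show ?thesis
    unfolding poincare_const_def
  proof (intro conjI ballI)
    show "0 < a * b"
      using ab by simp
    fix x y assume xy: "x \<in> verts G1 \<rightarrow> X" "y \<in> verts G1 \<rightarrow> X"
    let ?n = "real (card (verts G1))"
    have "1 / ?n\<^sup>2 * (\<Sum>i\<in>verts G1. \<Sum>j\<in>verts G1. K (x i) (y j))
      \<le> a / ?n * (\<Sum>i\<in>verts G1. \<Sum>j\<in>verts G1.
        normalized_adjacency (derandomized_square G1 (complete_graph (verts G2)) \<pi>) i j * K (x i) (y j))"
      using a xy by (rule poincare_constD)
    \<comment> \<open>The complete graph on \<open>d1\<close> labels is \<open>d1\<close>-regular,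
      whence the denominator \<open>d1 * d1\<close>.\<close>
    also have "\<dots> = a / ?n * (\<Sum>w\<in>verts G1.
        (\<Sum>s\<in>verts G2. \<Sum>t\<in>verts G2. K (x (\<tau> w s)) (y (\<tau> w t))) / (real d1 * real d1))"
      unfolding sum_normalized_adjacency_derandomized_square[OF G1 complete] \<tau>_def
      by (simp add: complete_graph_def sum_divide_distrib)
    also have "\<dots> \<le> a / ?n * (\<Sum>w\<in>verts G1.
        b * (\<Sum>s\<in>verts G2. \<Sum>t\<in>verts G2. real (mult G2 s t) * K (x (\<tau> w s)) (y (\<tau> w t)))
          / (real d1 * real d2))"
      using ab by (intro mult_left_mono sum_mono local_bound xy) auto
    also have "\<dots> = a * b / ?n * (\<Sum>i\<in>verts G1. \<Sum>j\<in>verts G1.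
        normalized_adjacency (derandomized_square G1 G2 \<pi>) i j * K (x i) (y j))"
      unfolding sum_normalized_adjacency_derandomized_square[OF G1 G2(2) lab] \<tau>_def
      by (simp add: sum_distrib_left sum_divide_distrib mult.assoc)
    finally show "1 / ?n\<^sup>2 * (\<Sum>i\<in>verts G1. \<Sum>j\<in>verts G1. K (x i) (y j))
      \<le> a * b / ?n * (\<Sum>i\<in>verts G1. \<Sum>j\<in>verts G1.
        normalized_adjacency (derandomized_square G1 G2 \<pi>) i j * K (x i) (y j))" .
  qed
qed

section \<open>Passing to infima in the extended nonnegative reals\<close>

lemma le_mult_if_divide_le_ennreal:
  fixes a b c :: ennreal
  assumes "c / b \<le> a" "b \<noteq> 0" "b \<noteq> top"
  shows "c \<le> a * b"
proof -
  have "c = c / b * b"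
    using assms(2,3) by (simp add: ennreal_divide_times top.not_eq_extremum ennreal_divide_self)
  also have "\<dots> \<le> a * b"
    using assms(1) by (rule mult_right_mono) simp
  finally show ?thesis .
qed

text \<open>If a factor is 0, the kernel vanishes and so does the left side. If neither is 0 and one
  is infinite, the right side is infinite. Otherwise the two infima are taken one after the other,
  by dividing out the other factor.\<close>

lemma gamma_plus_le_mult:
  assumes I: "finite I" "I \<noteq> {}" and J: "finite J" "J \<noteq> {}" and K: "kernel_on X K"
    and mult: "\<And>a b. poincare_const I A X K a \<Longrightarrow> poincare_const J B X K b \<Longrightarrow>
      poincare_const L C X K (a * b)"
  shows "gamma_plus L C X K \<le> gamma_plus I A X K * gamma_plus J B X K"
proof (cases "gamma_plus I A X K = 0 \<or> gamma_plus J B X K = 0")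
  case True
  then have "K p q = 0" if "p \<in> X" "q \<in> X" for p q
    using kernel_eq_0_if_gamma_plus_eq_0 I J K that by metis
  then have "gamma_plus L C X K = 0"
    by (rule gamma_plus_eq_0_if_kernel_eq_0)
  then show ?thesis by simp
next
  case False
  show ?thesis
  proof (cases "gamma_plus I A X K = top \<or> gamma_plus J B X K = top")
    case True
    then have "gamma_plus I A X K * gamma_plus J B X K = top"
      using False by (auto simp: ennreal_mult_top ennreal_top_mult)
    then show ?thesis by simp
  next
    case fin: False
    let ?c = "gamma_plus L C X K" and ?a = "gamma_plus I A X K" and ?b = "gamma_plus J B X K"
    have prod: "?c \<le> ennreal a * ennreal b"
      if "poincare_const I A X K a" "poincare_const J B X K b" for a b
      using gamma_plus_le[OF mult[OF that]] that by (simp add: poincare_const_def ennreal_mult)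
    \<comment> \<open>With \<open>b\<close> fixed, this is the infimum over
      \<open>a\<close>.\<close>
    have left: "?c / ennreal b \<le> ?a" if b: "poincare_const J B X K b" for b
      unfolding gamma_plus_eq_Inf[of I]
    proof (rule Inf_greatest, clarify)
      fix a assume "poincare_const I A X K a"
      with b show "?c / ennreal b \<le> ennreal a"
        by (intro divide_le_posI_ennreal) (auto simp: poincare_const_def prod mult.commute)
    qed
    \<comment> \<open>Now \<open>?a\<close> is divided out, which is possible as it is nonzero, and
      the infimum over \<open>b\<close> is taken.\<close>
    have "?c / ?a \<le> ?b"
      unfolding gamma_plus_eq_Inf[of J]
    proof (rule Inf_greatest, clarify)
      fix b assume b: "poincare_const J B X K b"
      then have "?c \<le> ?a * ennreal b"
        using left[OF b] by (intro le_mult_if_divide_le_ennreal) (auto simp: poincare_const_def)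
      then show "?c / ?a \<le> ennreal b"
        using False by (intro divide_le_posI_ennreal) (auto simp: mult.commute zero_less_iff_neq_zero)
    qed
    then show ?thesis
      using fin False by (subst mult.commute) (intro le_mult_if_divide_le_ennreal, auto)
  qed
qed

theorem proposition8p10:
  fixes n1 d1 d2 :: nat
    and G1 :: "'a multigraph" and G2 :: "'b multigraph"
    and \<pi> :: "'a \<Rightarrow> 'a \<times> 'a \<times> nat \<Rightarrow> 'b"
    and X :: "'x set" and K :: "'x \<Rightarrow> 'x \<Rightarrow> real"
  assumes "0 < n1" "0 < d1" "0 < d2"
    and "is_graph G1" "card (verts G1) = n1" "regular d1 G1"
    and "is_graph G2" "card (verts G2) = d1" "regular d2 G2"
    and "labeling G1 G2 \<pi>"
    and "kernel_on X K"
  shows "graph_gamma_plus (derandomized_square G1 G2 \<pi>) X K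
           \<le> graph_gamma_plus (graph_square G1) X K * graph_gamma_plus G2 X K"
proof -
  let ?H = "derandomized_square G1 (complete_graph (verts G2)) \<pi>"
  have verts: "verts (derandomized_square G1 G \<pi>) = verts G1" for G :: "'b multigraph"
    by (simp add: derandomized_square_def)
  have "gamma_plus (verts G1) (normalized_adjacency (derandomized_square G1 G2 \<pi>)) X K
      \<le> gamma_plus (verts G1) (normalized_adjacency ?H) X K
        * gamma_plus (verts G2) (normalized_adjacency G2) X K"
  proof (rule gamma_plus_le_mult)
    \<comment> \<open>Nonemptiness comes from the positive cardinalities \<open>n1\<close> and
      \<open>d1\<close>.\<close>
    show "finite (verts G1)" "verts G1 \<noteq> {}" "finite (verts G2)" "verts G2 \<noteq> {}"
      using assms by (auto simp: is_graph_def)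
    show "kernel_on X K" by fact
  qed (rule poincare_const_mult[OF assms(2,3,4,6,8,9,10)])
  then show ?thesis
    unfolding graph_gamma_plus_graph_square[OF assms(4), of X K "verts G2" \<pi>]
    by (simp only: graph_gamma_plus_def verts)
qed

end
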